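(* Let $m\ge 2$ be an integer with $m\equiv 0 \pmod 2$ and let $f:\mathbb{Z}_2\to\mathbb{Z}_2$, $f(x)=x^m$. Then the minimal decomposition of $\mathbb{Z}_2$ for $f$ is $$\mathbb{Z}_2=\{0,1\}\ \bigsqcup\ \Big((2\mathbb{Z}_2\setminus\{0\})\cup\big((1+2\mathbb{Z}_2)\setminus\{1\}\big)\Big).$$ Here $\{0,1\}$ is the set of periodic points (all of them fixed points), there are no minimal components, and the other sets are the attracting basin of $\{0,1\}$.
   Context: $\mathbb{Z}_2$ is the ring of $2$-adic integers with its $2$-adic metric. For a polynomial $f$ over $\mathbb{Z}_p$, a minimal decomposition of $\mathbb{Z}_p$ for $f$ is a partition $\mathbb{Z}_p=\mathcal{P}\sqcup\mathcal{M}\sqcup\mathcal{B}$ where (1) $\mathcal{P}$ is the set of all periodic points of $f$; (2) $\mathcal{M}=\bigsqcup_i\mathcal{M}_i$ is a disjoint union of at most countably many clopen $f$-invariant sets, each a finite union of balls, such that each subsystem $f:\mathcal{M}_i\to\mathcal{M}_i$ is minimal (every forward orbit in $\mathcal{M}_i$ is dense in $\mathcal{M}_i$); the $\mathcal{M}_i$ are called minimal components; (3) each point of $\mathcal{B}$ lies in the attracting basin of a periodic orbit or of a minimal component. A point $x$ lies in the attracting basin of a closed invariant set $A$ if the distance from $f^n(x)$ to $A$ tends to $0$ as $n\to\infty$. *)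

theory Defs
  imports "HOL-Analysis.Analysis"
begin

section \<open>The 2-adic integers\<close>

text \<open>The inverse limit of the rings Z/2^n: the n-th entry of a coherent sequence is the
  canonical representative in {0..<2^n} of the class modulo 2^n.\<close>

typedef two_adic_int =
  "{x :: nat \<Rightarrow> int. \<forall>n. x n \<in> {0..<2 ^ n} \<and> x (Suc n) mod 2 ^ n = x n}"
  morphisms residue Abs_two_adic_int
  by (rule exI[of _ "\<lambda>_. 0"]) simp

setup_lifting type_definition_two_adic_int

lemma mod_pow_Suc_mod [simp]: "(a :: int) mod (2 * 2 ^ n) mod 2 ^ n = a mod 2 ^ n"
  by (rule mod_mod_cancel) simp

lemma coherent_mod:
  assumes "\<forall>n. x n \<in> {0..<2 ^ n} \<and> x (Suc n) mod 2 ^ n = (x n :: int)"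
  shows "x n mod 2 ^ n = x n"
  using assms by auto

instantiation two_adic_int :: comm_ring_1
begin

lift_definition zero_two_adic_int :: two_adic_int is "\<lambda>_. 0" by simp

lift_definition one_two_adic_int :: two_adic_int is "\<lambda>n. 1 mod 2 ^ n" by simp

lift_definition plus_two_adic_int :: "two_adic_int \<Rightarrow> two_adic_int \<Rightarrow> two_adic_int"
  is "\<lambda>x y n. (x n + y n) mod 2 ^ n"
proof (intro allI conjI)
  fix x y :: "nat \<Rightarrow> int" and n
  assume x: "\<And>n. x n \<in> {0..<2 ^ n} \<and> x (Suc n) mod 2 ^ n = x n"
    and y: "\<And>n. y n \<in> {0..<2 ^ n} \<and> y (Suc n) mod 2 ^ n = y n"
  show "(x n + y n) mod 2 ^ n \<in> {0..<2 ^ n}" by simp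
  have "(x (Suc n) + y (Suc n)) mod 2 ^ n = (x (Suc n) mod 2 ^ n + y (Suc n) mod 2 ^ n) mod 2 ^ n"
    by (simp only: mod_add_eq)
  then show "(x (Suc n) + y (Suc n)) mod 2 ^ Suc n mod 2 ^ n = (x n + y n) mod 2 ^ n"
    using x y by simp
qed

lift_definition uminus_two_adic_int :: "two_adic_int \<Rightarrow> two_adic_int"
  is "\<lambda>x n. (- x n) mod 2 ^ n"
proof (intro allI conjI)
  fix x :: "nat \<Rightarrow> int" and n
  assume x: "\<And>n. x n \<in> {0..<2 ^ n} \<and> x (Suc n) mod 2 ^ n = x n"
  show "(- x n) mod 2 ^ n \<in> {0..<2 ^ n}" by simp
  have "(- x (Suc n)) mod 2 ^ n = (- (x (Suc n) mod 2 ^ n)) mod 2 ^ n"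
    by (simp only: mod_minus_eq)
  then show "(- x (Suc n)) mod 2 ^ Suc n mod 2 ^ n = (- x n) mod 2 ^ n"
    using x by simp
qed

lift_definition times_two_adic_int :: "two_adic_int \<Rightarrow> two_adic_int \<Rightarrow> two_adic_int"
  is "\<lambda>x y n. (x n * y n) mod 2 ^ n"
proof (intro allI conjI)
  fix x y :: "nat \<Rightarrow> int" and n
  assume x: "\<And>n. x n \<in> {0..<2 ^ n} \<and> x (Suc n) mod 2 ^ n = x n"
    and y: "\<And>n. y n \<in> {0..<2 ^ n} \<and> y (Suc n) mod 2 ^ n = y n"
  show "(x n * y n) mod 2 ^ n \<in> {0..<2 ^ n}" by simp
  have "(x (Suc n) * y (Suc n)) mod 2 ^ n = ((x (Suc n) mod 2 ^ n) * (y (Suc n) mod 2 ^ n)) mod 2 ^ n"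
    by (simp only: mod_mult_eq)
  then show "(x (Suc n) * y (Suc n)) mod 2 ^ Suc n mod 2 ^ n = (x n * y n) mod 2 ^ n"
    using x y by simp
qed

definition minus_two_adic_int :: "two_adic_int \<Rightarrow> two_adic_int \<Rightarrow> two_adic_int"
  where "minus_two_adic_int x y = x + - y"

instance
proof
  fix a b c :: two_adic_int
  show "a * b * c = a * (b * c)"
    by transfer (simp add: fun_eq_iff mod_mult_left_eq mod_mult_right_eq mult.assoc)
  show "a * b = b * a"
    by transfer (simp add: fun_eq_iff mult.commute)
  show "1 * a = a"
    by transfer (simp add: fun_eq_iff mod_mult_left_eq coherent_mod del: one_mod_2_pow_eq)
  show "a + b + c = a + (b + c)"
    by transfer (simp add: fun_eq_iff mod_add_left_eq mod_add_right_eq add.assoc)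
  show "a + b = b + a"
    by transfer (simp add: fun_eq_iff add.commute)
  show "0 + a = a"
    by transfer (simp add: fun_eq_iff)
  show "- a + a = 0"
    by transfer (simp add: fun_eq_iff mod_add_left_eq)
  show "a - b = a + - b"
    by (rule minus_two_adic_int_def)
  show "(a + b) * c = a * c + b * c"
    by transfer (simp add: fun_eq_iff mod_add_left_eq mod_add_right_eq mod_mult_left_eq distrib_right)
  show "(0 :: two_adic_int) \<noteq> 1"
    by transfer (auto simp: fun_eq_iff intro!: exI[of _ 1])
qed

end

lemma residue_range: "0 \<le> residue x n" "residue x n < 2 ^ n"
  using residue[of x] by auto

lemma residue_Suc_mod: "residue x (Suc n) mod 2 ^ n = residue x n"
  using residue[of x] by auto

lemma residue_mod: "m \<le> n \<Longrightarrow> residue x n mod 2 ^ m = residue x m"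
proof (induction n rule: dec_induct)
  case base
  show ?case by (simp add: residue_range)
next
  case (step n)
  have "residue x (Suc n) mod 2 ^ m = residue x (Suc n) mod 2 ^ n mod 2 ^ m"
    using step.hyps by (simp add: mod_mod_cancel le_imp_power_dvd)
  then show ?case by (simp only: residue_Suc_mod step.IH)
qed

lemma residue_minus: "residue (x - y) n = (residue x n - residue y n) mod 2 ^ n"
  unfolding minus_two_adic_int_def
  by (simp add: plus_two_adic_int.rep_eq uminus_two_adic_int.rep_eq mod_add_right_eq flip: add_uminus_conv_diff)

lemma two_adic_int_eq_iff: "x = y \<longleftrightarrow> (\<forall>n. residue x n = residue y n)"
  by (metis ext residue_inject)

lemma residue_of_nat: "residue (of_nat k) n = int k mod 2 ^ n"
  by (induction k)
     (simp_all add: zero_two_adic_int.rep_eq one_two_adic_int.rep_eq plus_two_adic_int.rep_eq mod_add_right_eq)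

lemma residue_eq_0_iff: "residue x n = 0 \<longleftrightarrow> 2 ^ n dvd x"
proof
  assume "2 ^ n dvd x"
  then obtain y where "x = of_nat (2 ^ n) * y" by (auto elim: dvdE)
  then show "residue x n = 0"
    by (simp only: times_two_adic_int.rep_eq residue_of_nat) simp
next
  assume *: "residue x n = 0"
  define y where "y k = residue x (k + n) div 2 ^ n" for k
  have dv: "2 ^ n dvd residue x (k + n)" for k
    using residue_mod[of n "k + n" x] * by (simp add: dvd_eq_mod_eq_0)
  have y: "\<forall>k. y k \<in> {0..<2 ^ k} \<and> y (Suc k) mod 2 ^ k = y k"
  proof (intro allI conjI)
    fix k
    have "residue x (k + n) < 2 ^ k * 2 ^ n"
      using residue_range[of x "k + n"] by (simp add: power_add)
    then have "2 ^ n * y k < 2 ^ n * 2 ^ k"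
      using dv[of k] by (simp add: y_def mult.commute)
    moreover have "0 \<le> y k"
      by (simp add: y_def residue_range pos_imp_zdiv_nonneg_iff)
    ultimately show "y k \<in> {0..<2 ^ k}" by simp
    have "2 ^ n * (y (Suc k) mod 2 ^ k) = (2 ^ n * y (Suc k)) mod (2 ^ n * 2 ^ k)"
      by (rule mult_mod_right)
    also have "\<dots> = residue x (Suc (k + n)) mod 2 ^ (k + n)"
      using dv[of "Suc k"] by (simp add: y_def power_add mult.commute)
    also have "\<dots> = residue x (k + n)" by (rule residue_Suc_mod)
    also have "\<dots> = 2 ^ n * y k" using dv[of k] by (simp add: y_def)
    finally show "y (Suc k) mod 2 ^ k = y k" by simp
  qed
  have i: "int (2 ^ n) = 2 ^ n" by simp
  have "x = of_nat (2 ^ n) * Abs_two_adic_int y"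
    unfolding two_adic_int_eq_iff
  proof
    fix k
    have "residue (of_nat (2 ^ n) * Abs_two_adic_int y) k = (2 ^ n * y k) mod 2 ^ k"
      using y by (simp add: times_two_adic_int.rep_eq residue_of_nat Abs_two_adic_int_inverse
          mod_mult_left_eq i del: of_nat_power)
    also have "2 ^ n * y k = residue x (k + n)" using dv[of k] by (simp add: y_def)
    also have "residue x (k + n) mod 2 ^ k = residue x k" by (rule residue_mod) simp
    finally show "residue x k = residue (of_nat (2 ^ n) * Abs_two_adic_int y) k" by simp
  qed
  then show "2 ^ n dvd x" by simp
qed

text \<open>The 2-adic valuation is only meaningful for nonzero arguments.\<close>

definition two_adic_val :: "two_adic_int \<Rightarrow> nat"
  where "two_adic_val x = (GREATEST n. 2 ^ n dvd x)"

definition two_adic_abs :: "two_adic_int \<Rightarrow> real"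
  where "two_adic_abs x = (if x = 0 then 0 else (1 / 2) ^ two_adic_val x)"

lemma pow_dvd_iff_le_two_adic_val:
  assumes "x \<noteq> 0"
  shows "2 ^ n dvd x \<longleftrightarrow> n \<le> two_adic_val x"
proof -
  obtain b where b: "residue x b \<noteq> 0"
    using assms by (auto simp: two_adic_int_eq_iff zero_two_adic_int.rep_eq)
  have le: "k \<le> b" if "2 ^ k dvd x" for k
    using that b by (metis dvd_trans le_imp_power_dvd linear residue_eq_0_iff)
  have "2 ^ two_adic_val x dvd x"
    unfolding two_adic_val_def by (rule GreatestI_nat[where k = 0 and b = b]) (use le in auto)
  moreover have "n \<le> two_adic_val x" if "2 ^ n dvd x"
    unfolding two_adic_val_def by (rule Greatest_le_nat[where b = b]) (use that le in auto)
  ultimately show ?thesis by (meson dvd_trans le_imp_power_dvd)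
qed

lemma two_adic_abs_le_iff: "two_adic_abs x \<le> (1 / 2) ^ n \<longleftrightarrow> 2 ^ n dvd x"
  by (cases "x = 0")
     (auto simp: two_adic_abs_def pow_dvd_iff_le_two_adic_val)

lemma two_adic_abs_cases: "two_adic_abs x = 0 \<and> x = 0 \<or> (\<exists>n. two_adic_abs x = (1 / 2) ^ n)"
  by (auto simp: two_adic_abs_def)

lemma two_adic_abs_ultrametric:
  "two_adic_abs (x + y) \<le> max (two_adic_abs x) (two_adic_abs y)"
proof -
  consider "x = 0" | "y = 0" | n where "max (two_adic_abs x) (two_adic_abs y) = (1 / 2) ^ n"
    using two_adic_abs_cases[of x] two_adic_abs_cases[of y] by (metis max_def)
  then show ?thesis
  proof cases
    case 3
    then have "two_adic_abs x \<le> (1 / 2) ^ n" "two_adic_abs y \<le> (1 / 2) ^ n" by linarith+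
    then show ?thesis unfolding 3 two_adic_abs_le_iff by (rule dvd_add)
  qed auto
qed

lemma two_adic_abs_nonneg: "0 \<le> two_adic_abs x"
  by (simp add: two_adic_abs_def)

lemma two_adic_abs_minus: "two_adic_abs (- x) = two_adic_abs x"
  by (simp add: two_adic_abs_def two_adic_val_def)

instantiation two_adic_int :: metric_space
begin

definition dist_two_adic_int :: "two_adic_int \<Rightarrow> two_adic_int \<Rightarrow> real"
  where "dist_two_adic_int x y = two_adic_abs (x - y)"

definition uniformity_two_adic_int :: "(two_adic_int \<times> two_adic_int) filter"
  where "uniformity_two_adic_int = (INF e\<in>{0<..}. principal {(x, y). dist x y < e})"

definition open_two_adic_int :: "two_adic_int set \<Rightarrow> bool"
  where "open_two_adic_int U \<longleftrightarrow> (\<forall>x\<in>U. \<forall>\<^sub>F (x', y) in uniformity. x' = x \<longrightarrow> y \<in> U)"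

instance
proof
  fix x y z :: two_adic_int
  show "dist x y = 0 \<longleftrightarrow> x = y"
    by (simp add: dist_two_adic_int_def two_adic_abs_def)
  have "two_adic_abs (x - y) = two_adic_abs ((x - z) + - (y - z))" by simp
  also have "\<dots> \<le> max (two_adic_abs (x - z)) (two_adic_abs (- (y - z)))"
    by (rule two_adic_abs_ultrametric)
  also have "\<dots> \<le> two_adic_abs (x - z) + two_adic_abs (y - z)"
    using two_adic_abs_nonneg[of "x - z"] two_adic_abs_nonneg[of "y - z"]
    by (simp only: two_adic_abs_minus)
  finally show "dist x y \<le> dist x z + dist y z"
    by (simp only: dist_two_adic_int_def)
next
  show "uniformity = (INF e\<in>{0<..}. principal {(x :: two_adic_int, y). dist x y < e})"
    by (rule uniformity_two_adic_int_def)
next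
  fix U :: "two_adic_int set"
  show "open U \<longleftrightarrow> (\<forall>x\<in>U. \<forall>\<^sub>F (x', y) in uniformity. x' = x \<longrightarrow> y \<in> U)"
    by (rule open_two_adic_int_def)
qed

end

section \<open>Minimal decompositions\<close>

definition forward_orbit :: "('a \<Rightarrow> 'a) \<Rightarrow> 'a \<Rightarrow> 'a set"
  where "forward_orbit f x = range (\<lambda>n. (f ^^ n) x)"

definition periodic_points :: "('a \<Rightarrow> 'a) \<Rightarrow> 'a set"
  where "periodic_points f = {x. \<exists>n>0. (f ^^ n) x = x}"

text \<open>Only used for nonempty closed invariant sets (\<open>infdist\<close> to the empty set is 0).\<close>

definition attracting_basin :: "('a::metric_space \<Rightarrow> 'a) \<Rightarrow> 'a set \<Rightarrow> 'a set"
  where "attracting_basin f A = {x. (\<lambda>n. infdist ((f ^^ n) x) A) \<longlonglongrightarrow> 0}"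

definition finite_union_of_balls :: "'a::metric_space set \<Rightarrow> bool"
  where "finite_union_of_balls S \<longleftrightarrow>
    (\<exists>F. finite F \<and> (\<forall>(c, r)\<in>F. r > 0) \<and> S = (\<Union>(c, r)\<in>F. ball c r))"

text \<open>The empty set would satisfy all conditions vacuously and is excluded.\<close>

definition minimal_component :: "('a::metric_space \<Rightarrow> 'a) \<Rightarrow> 'a set \<Rightarrow> bool"
  where "minimal_component f M \<longleftrightarrow>
    M \<noteq> {} \<and> open M \<and> closed M \<and> finite_union_of_balls M \<and> f ` M \<subseteq> M \<and>
    (\<forall>x\<in>M. M \<subseteq> closure (forward_orbit f x))"

text \<open>The set \<open>\<C>\<close> collects the minimal components, so the middle part of the partition is
  its union.\<close>

definition minimal_decomposition ::
    "('a::metric_space \<Rightarrow> 'a) \<Rightarrow> 'a set \<Rightarrow> 'a set set \<Rightarrow> 'a set \<Rightarrow> bool"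
  where "minimal_decomposition f P \<C> B \<longleftrightarrow>
    P \<union> \<Union>\<C> \<union> B = UNIV \<and> P \<inter> \<Union>\<C> = {} \<and> P \<inter> B = {} \<and> \<Union>\<C> \<inter> B = {} \<and>
    P = periodic_points f \<and>
    countable \<C> \<and> disjoint \<C> \<and> (\<forall>M\<in>\<C>. minimal_component f M) \<and>
    (\<forall>x\<in>B. (\<exists>p\<in>periodic_points f. x \<in> attracting_basin f (forward_orbit f p)) \<or>
            (\<exists>M\<in>\<C>. x \<in> attracting_basin f M))"

end

theory Submission
  imports Defs
begin

text \<open>A power map with even exponent at least 2 contracts both cosets of the ideal generated by 2:
  an even base becomes more divisible by 2 with every application, and for an odd base the
  factorization of \<open>u\<^sup>2 - 1\<close> into \<open>u - 1\<close> and the even factor \<open>u + 1\<close> gains one power of 2 each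
  time. Every orbit therefore converges to one of the fixed points 0 and 1, which leaves no further
  periodic points. A minimal component would contain such a limit and equal its orbit, a single
  point, but the ring has no isolated points.\<close>

lemma dist_two_adic_int_le_iff: "dist x y \<le> (1 / 2) ^ n \<longleftrightarrow> 2 ^ n dvd x - (y :: two_adic_int)"
  by (simp add: dist_two_adic_int_def two_adic_abs_le_iff)

text \<open>The index doubles as the precision: the n-th term is within \<open>(1 / 2) ^ n\<close>
  of \<open>a\<close>, so a geometric sequence dominates the distance.\<close>

lemma tendsto_two_adic_intI:
  fixes a :: two_adic_int
  assumes "\<And>n. 2 ^ n dvd s n - a"
  shows "s \<longlonglongrightarrow> a"
proof (rule metric_tendsto_imp_tendsto)
  show "(\<lambda>n. (1 / 2 :: real) ^ n) \<longlonglongrightarrow> 0" by (rule LIMSEQ_power_zero) simp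
  show "\<forall>\<^sub>F n in sequentially. dist (s n) a \<le> dist ((1 / 2 :: real) ^ n) 0"
    using assms by (simp add: dist_two_adic_int_le_iff)
qed

text \<open>Level \<open>Suc n\<close> is the first at which the residue of \<open>2 ^ n\<close>
  does not vanish. This keeps the points \<open>a + 2 ^ n\<close> below distinct from their limit
  \<open>a\<close>.\<close>

lemma two_adic_int_power2_neq_0: "(2 :: two_adic_int) ^ n \<noteq> 0"
proof
  assume "(2 :: two_adic_int) ^ n = 0"
  then have "residue (2 ^ n) (Suc n) = 0" by (simp add: zero_two_adic_int.rep_eq)
  moreover have "residue (2 ^ n) (Suc n) = 2 ^ n"
    using residue_of_nat[of "2 ^ n" "Suc n"] by (simp add: mod_pos_pos_trivial)
  ultimately show False by simp
qed

lemma two_adic_int_not_open_singleton: "\<not> open {a :: two_adic_int}"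
proof
  assume "open {a}"
  have "(\<lambda>n. a + 2 ^ n) \<longlonglongrightarrow> a" by (rule tendsto_two_adic_intI) simp
  from topological_tendstoD[OF this \<open>open {a}\<close>]
  have "\<forall>\<^sub>F n in sequentially. a + 2 ^ n \<in> {a}" by simp
  then show False by (simp add: two_adic_int_power2_neq_0)
qed

lemma two_adic_int_even_or_odd:
  fixes x :: two_adic_int
  obtains "2 dvd x" | "2 dvd x - 1"
proof -
  have "residue x 1 = 0 \<or> residue x 1 = 1" using residue_range[of x 1] by auto
  then show thesis
  proof
    assume "residue x 1 = 0"
    then show thesis using that(1) residue_eq_0_iff[of x 1] by simp
  next
    assume "residue x 1 = 1"
    then have "residue (x - 1) 1 = 0" by (simp add: residue_minus one_two_adic_int.rep_eq)
    then show thesis using that(2) residue_eq_0_iff[of "x - 1" 1] by simp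
  qed
qed

lemma two_adic_int_one_not_even: "\<not> 2 dvd (1 :: two_adic_int)"
  using residue_eq_0_iff[of 1 1] by (simp add: one_two_adic_int.rep_eq)

lemma power_dvd_iterate_even:
  fixes x :: "'a :: comm_ring_1"
  assumes "m \<ge> 2" "2 dvd x"
  shows "2 ^ Suc n dvd ((\<lambda>x. x ^ m) ^^ n) x"
proof (induction n)
  case 0
  show ?case using assms by simp
next
  case (Suc n)
  let ?u = "((\<lambda>x. x ^ m) ^^ n) x"
  \<comment> \<open>Squaring doubles the exponent, and 2(n + 1) is at least n + 2; the linear rate
    is all that convergence requires.\<close>
  have "2 ^ Suc (Suc n) dvd (2 ^ Suc n :: 'a) ^ 2"
    unfolding power_mult[symmetric] by (rule le_imp_power_dvd) simp
  also have "\<dots> dvd ?u ^ 2" by (rule dvd_power_same) (rule Suc)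
  also have "\<dots> dvd ?u ^ m" by (rule le_imp_power_dvd) (rule assms)
  finally show ?case by simp
qed

lemma power_dvd_iterate_odd:
  fixes x :: "'a :: comm_ring_1"
  assumes "even m" "2 dvd x - 1"
  shows "2 ^ Suc n dvd ((\<lambda>x. x ^ m) ^^ n) x - 1"
proof (induction n)
  case 0
  show ?case using assms by simp
next
  case (Suc n)
  let ?u = "((\<lambda>x. x ^ m) ^^ n) x"
  obtain k where k: "m = 2 * k" using assms(1) by (rule evenE)
  \<comment> \<open>The induction hypothesis enters twice: weakened to parity here, to make
    \<open>?u + 1\<close> even, and at full strength for the factor \<open>?u - 1\<close>.\<close>
  have "2 dvd ?u - 1" using Suc by (rule dvd_trans[rotated]) simp
  then have "2 dvd (?u - 1) + 2" by (rule dvd_add) simp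
  also have "(?u - 1) + 2 = ?u + 1" by (simp add: algebra_simps)
  finally have "2 dvd ?u + 1" .
  with Suc have "2 ^ Suc n * 2 dvd (?u - 1) * (?u + 1)" by (rule mult_dvd_mono)
  also have "(?u - 1) * (?u + 1) = ?u ^ 2 - 1" by (simp add: algebra_simps power2_eq_square)
  \<comment> \<open>The cofactor is the geometric sum in \<open>?u ^ 2\<close>.\<close>
  also have "\<dots> dvd (?u ^ 2) ^ k - 1" by (simp add: power_diff_1_eq)
  also have "(?u ^ 2) ^ k = ?u ^ m" by (simp only: k power_mult)
  finally show ?case by (simp add: mult.commute)
qed

lemma iterate_even_power_tendsto:
  fixes x :: two_adic_int
  assumes "m \<ge> 2" "even m"
  obtains a where "a \<in> {0, 1}" "(\<lambda>n. ((\<lambda>x. x ^ m) ^^ n) x) \<longlonglongrightarrow> a"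
proof (cases rule: two_adic_int_even_or_odd[of x])
  case 1
  have "(\<lambda>n. ((\<lambda>x. x ^ m) ^^ n) x) \<longlonglongrightarrow> 0"
    \<comment> \<open>The iterate is divisible by \<open>2 ^ Suc n\<close>; one factor 2 is dropped
      to match the convergence criterion.\<close>
    using dvd_mult_right[OF power_dvd_iterate_even[OF assms(1) 1, unfolded power_Suc]]
    by (intro tendsto_two_adic_intI) simp
  then show thesis by (rule that[rotated]) simp
next
  case 2
  have "(\<lambda>n. ((\<lambda>x. x ^ m) ^^ n) x) \<longlonglongrightarrow> 1"
    using dvd_mult_right[OF power_dvd_iterate_odd[OF assms(2) 2, unfolded power_Suc]]
    by (rule tendsto_two_adic_intI)
  then show thesis by (rule that[rotated]) simp
qed

lemma funpow_fixpoint: "f x = x \<Longrightarrow> (f ^^ n) x = x"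
  by (induction n) auto

lemma forward_orbit_fixpoint: "f x = x \<Longrightarrow> forward_orbit f x = {x}"
  by (auto simp: forward_orbit_def funpow_fixpoint)

text \<open>The distance to a set is at most the distance to any of its points, so it is squeezed to
  0.\<close>

lemma attracting_basinI_tendsto:
  assumes "(\<lambda>n. (f ^^ n) x) \<longlonglongrightarrow> a" "a \<in> A"
  shows "x \<in> attracting_basin f A"
  unfolding attracting_basin_def mem_Collect_eq
proof (rule tendsto_sandwich[OF _ _ tendsto_const])
  show "(\<lambda>n. dist ((f ^^ n) x) a) \<longlonglongrightarrow> 0" using assms(1) by (rule tendsto_dist_iff[THEN iffD1])
qed (simp_all add: infdist_nonneg infdist_le[OF assms(2)])

text \<open>Along the multiples of a period the orbit is constantly \<open>x\<close>, and limits are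
  unique in a Hausdorff space.\<close>

lemma periodic_point_tendsto_eq:
  fixes f :: "'a :: t2_space \<Rightarrow> 'a"
  assumes "x \<in> periodic_points f" "(\<lambda>n. (f ^^ n) x) \<longlonglongrightarrow> a"
  shows "x = a"
proof -
  obtain n where n: "n > 0" "(f ^^ n) x = x" using assms(1) by (auto simp: periodic_points_def)
  have "strict_mono (\<lambda>k. n * k)" using n(1) by (simp add: strict_mono_def)
  from LIMSEQ_subseq_LIMSEQ[OF assms(2) this]
  have "(\<lambda>k. (f ^^ (n * k)) x) \<longlonglongrightarrow> a" by (simp add: o_def)
  moreover have "(f ^^ (n * k)) x = x" for k
    using funpow_fixpoint[of "f ^^ n" x k] n(2) by (simp add: funpow_mult)
  ultimately show ?thesis by (simp add: LIMSEQ_const_iff)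
qed

theorem theorem3p2:
  fixes m :: nat and f :: "two_adic_int \<Rightarrow> two_adic_int" and B :: "two_adic_int set"
  assumes "m \<ge> 2" and "m mod 2 = 0"
    and "f = (\<lambda>x. x ^ m)"
    and "B = (range (\<lambda>y. 2 * y) - {0}) \<union> (range (\<lambda>y. 1 + 2 * y) - {1})"
  shows "minimal_decomposition f {0, 1} {} B
    \<and> periodic_points f = {0, 1} \<and> (\<forall>x\<in>{0, 1}. f x = x)
    \<and> (\<nexists>M. minimal_component f M)
    \<and> B = attracting_basin f {0, 1} - {0, 1}"
proof -
  have "even m" using assms(2) by auto
  then have lim: "\<exists>a\<in>{0, 1}. (\<lambda>n. (f ^^ n) x) \<longlonglongrightarrow> a" for x
    using iterate_even_power_tendsto[OF assms(1), of x] unfolding assms(3) by blast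
  have fixed: "f x = x" if "x \<in> {0, 1}" for x
    using that assms(1) by (auto simp: assms(3) power_0_left)
  have "periodic_points f \<subseteq> {0, 1}" using lim periodic_point_tendsto_eq by blast
  moreover have "{0, 1} \<subseteq> periodic_points f"
    using fixed by (auto simp: periodic_points_def intro!: exI[of _ 1])
  ultimately have periodic: "periodic_points f = {0, 1}" by (rule antisym)
  have B: "B = - {0, 1}"
  proof -
    have "x \<in> range (\<lambda>y. 2 * y) \<longleftrightarrow> 2 dvd x" for x :: two_adic_int by auto
    moreover have "x \<in> range (\<lambda>y. 1 + 2 * y) \<longleftrightarrow> 2 dvd x - 1" for x :: two_adic_int
      by (auto simp: dvd_def algebra_simps image_iff)
    ultimately have "x \<in> B \<longleftrightarrow> 2 dvd x \<and> x \<noteq> 0 \<or> 2 dvd x - 1 \<and> x \<noteq> 1" for x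
      by (auto simp: assms(4))
    moreover have "2 dvd x \<or> 2 dvd x - 1" for x :: two_adic_int
      by (rule two_adic_int_even_or_odd) auto
    \<comment> \<open>If 1 lay in the even coset or 0 in the odd one, 2 would divide 1; so removing
      each fixed point from its own coset removes both from the union.\<close>
    ultimately show ?thesis using two_adic_int_one_not_even by fastforce
  qed
  have basin: "attracting_basin f {0, 1} = UNIV"
    using lim attracting_basinI_tendsto by blast
  \<comment> \<open>A minimal decomposition asks for attraction to a single periodic orbit, which is
    stronger than attraction to the set \<open>{0, 1}\<close>.\<close>
  have basin_orbit: "\<exists>p\<in>{0, 1}. x \<in> attracting_basin f (forward_orbit f p)" for x
  proof -
    obtain a where a: "a \<in> {0, 1}" "(\<lambda>n. (f ^^ n) x) \<longlonglongrightarrow> a" using lim[of x] by blast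
    have "a \<in> forward_orbit f a" using forward_orbit_fixpoint[of f a] fixed[OF a(1)] by simp
    from attracting_basinI_tendsto[OF a(2) this] a(1) show ?thesis by blast
  qed
  have no_component: "\<nexists>M. minimal_component f M"
  proof
    assume "\<exists>M. minimal_component f M"
    then obtain M where M: "M \<noteq> {}" "open M" "closed M" "f ` M \<subseteq> M"
      "\<And>x. x \<in> M \<Longrightarrow> M \<subseteq> closure (forward_orbit f x)"
      by (auto simp: minimal_component_def)
    obtain x where x: "x \<in> M" using M(1) by blast
    obtain a where a: "a \<in> {0, 1}" "(\<lambda>n. (f ^^ n) x) \<longlonglongrightarrow> a" using lim[of x] by blast
    have "(f ^^ n) x \<in> M" for n using x M(4) by (induction n) auto
    \<comment> \<open>Once the limit lies in \<open>M\<close>, minimality applies to its own orbit,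
      which is the closed set \<open>{a}\<close>.\<close>
    from closed_sequentially[OF M(3) this a(2)] have "a \<in> M" .
    moreover have "M \<subseteq> {a}"
      using M(5)[OF \<open>a \<in> M\<close>] forward_orbit_fixpoint[of f a] fixed[OF a(1)] by simp
    ultimately have "M = {a}" by blast
    then show False using M(2) two_adic_int_not_open_singleton by simp
  qed
  have "minimal_decomposition f {0, 1} {} B"
    unfolding minimal_decomposition_def periodic
    using basin_orbit by (simp add: B disjoint_def Compl_partition)
  moreover have "B = attracting_basin f {0, 1} - {0, 1}"
    unfolding B basin by (rule Compl_eq_Diff_UNIV)
  moreover have "\<forall>x\<in>{0, 1}. f x = x" by (rule ballI) (rule fixed)
  ultimately show ?thesis using periodic no_component by (intro conjI)
qed

end
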